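(* There is a universal sequence over an $8$-letter alphabet for $\operatorname{Aut}(\mathbb{Q},\leq)$. That is, if $A$ is an alphabet with exactly eight elements, there exists a sequence $w_1,w_2,\ldots$ of elements of the free semigroup $A^+$ such that for every sequence $f_1,f_2,\ldots$ of elements of $\operatorname{Aut}(\mathbb{Q},\leq)$ there is a semigroup homomorphism $\phi:A^+\to\operatorname{Aut}(\mathbb{Q},\leq)$ with $(w_i)\phi=f_i$ for all $i\in\mathbb{N}$.
   Context: $\mathbb{N}=\{1,2,3,\ldots\}$. $\operatorname{Aut}(\mathbb{Q},\leq)$ is the group (under composition) of all order-automorphisms of $\mathbb{Q}$, i.e. bijections $f:\mathbb{Q}\to\mathbb{Q}$ with $x\leq y$ if and only if $(x)f\leq (y)f$. Functions are written to the right of their arguments and composed from left to right. For an alphabet $A$, $A^+$ is the free semigroup freely generated by $A$ (non-empty words over $A$). Let $S$ be a semigroup and $T\subseteq S$. A sequence $w_1,w_2,\ldots$ of elements of $A^+$ is universal for $T$ as a subset of $S$ if for every sequence $t_1,t_2,\ldots\in T$ there is a semigroup homomorphism $\phi:A^+\to S$ with $(w_i)\phi=t_i$ for all $i\in\mathbb{N}$. It is universal for $S$ if it is universal for $S$ as a subset of $S$. *)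

theory Defs
  imports Complex_Main "HOL-Algebra.Group"
begin

text \<open>
  The free semigroup on an alphabet, realised as the non-empty words over it under concatenation.
  It has no identity element. HOL-Algebra has no record type for semigroups, so the \<open>one\<close> field
  of the monoid record is present but meaningless; it is never used, since \<^const>\<open>hom\<close> refers
  only to the carriers and the multiplications and is therefore the set of semigroup homomorphisms.
\<close>

definition free_semigroup :: "'a set \<Rightarrow> 'a list monoid" where
  "free_semigroup A =
     \<lparr>carrier = {u \<in> lists A. u \<noteq> []}, mult = (@), one = undefined\<rparr>"

text \<open>
  \<open>S\<close> is meant to be a semigroup and \<open>T\<close> a subset of its carrier. Sequences are indexed by the
  type \<^typ>\<open>nat\<close>, so that the first term has index 0.
\<close>

definition universal_for_subset ::
    "'a set \<Rightarrow> (nat \<Rightarrow> 'a list) \<Rightarrow> 's set \<Rightarrow> ('s, 'b) monoid_scheme \<Rightarrow> bool" where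
  "universal_for_subset A w T S \<longleftrightarrow>
     (\<forall>i. w i \<in> carrier (free_semigroup A)) \<and>
     (\<forall>t :: nat \<Rightarrow> 's. (\<forall>i. t i \<in> T) \<longrightarrow>
        (\<exists>\<phi> \<in> hom (free_semigroup A) S. \<forall>i. \<phi> (w i) = t i))"

definition universal_for ::
    "'a set \<Rightarrow> (nat \<Rightarrow> 'a list) \<Rightarrow> ('s, 'b) monoid_scheme \<Rightarrow> bool" where
  "universal_for A w S \<longleftrightarrow> universal_for_subset A w (carrier S) S"

text \<open>
  Maps act on the right and are composed from left to right: the product of \<open>f\<close> and \<open>g\<close>
  applies \<open>f\<close> first.
\<close>

definition Aut_rat :: "(rat \<Rightarrow> rat) monoid" where
  "Aut_rat =
     \<lparr>carrier = {f. bij f \<and> (\<forall>x y. x \<le> y \<longleftrightarrow> f x \<le> f y)},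
      mult = (\<lambda>f g. g \<circ> f), one = id\<rparr>"

lemma group_Aut_rat: "group Aut_rat"
proof (rule groupI)
  fix f assume "f \<in> carrier Aut_rat"
  then have b: "bij f" and o: "\<And>x y. x \<le> y \<longleftrightarrow> f x \<le> f y"
    by (auto simp: Aut_rat_def)
  have "x \<le> y \<longleftrightarrow> inv_into UNIV f x \<le> inv_into UNIV f y" for x y
    using o[of "inv_into UNIV f x" "inv_into UNIV f y"] b by (simp add: bij_is_surj f_inv_into_f)
  then have "inv_into UNIV f \<in> carrier Aut_rat"
    using b by (simp add: Aut_rat_def bij_imp_bij_inv)
  moreover have "inv_into UNIV f \<otimes>\<^bsub>Aut_rat\<^esub> f = \<one>\<^bsub>Aut_rat\<^esub>"
    using b by (simp add: Aut_rat_def fun_eq_iff bij_is_surj f_inv_into_f)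
  ultimately show "\<exists>g\<in>carrier Aut_rat. g \<otimes>\<^bsub>Aut_rat\<^esub> f = \<one>\<^bsub>Aut_rat\<^esub>" by blast
qed (auto simp: Aut_rat_def bij_comp comp_assoc)

end

theory Submission
  imports Defs "HOL-Library.Disjoint_Sets"
begin

text \<open>
  Conjugating all generators by one automorphism chosen from the given sequence, we may assume that
  the \<open>i\<close>-th automorphism moves points by less than \<open>1/4\<close> outside a bounded set depending only on
  \<open>i\<close>. Then it is a product of two automorphisms, supported on the images of a fixed periodic set
  \<open>W\<close> of intervals under two consecutive powers, depending only on \<open>i\<close>, of a fixed \<open>d\<close> that expands
  the middle and acts as a translation near either end. So only sequences \<open>h\<^sub>0, h\<^sub>1, \<dots>\<close> supported
  on \<open>W\<close> remain. Take \<open>s\<close>, supported on a slightly larger set \<open>I\<close>, whose powers move \<open>W\<close> to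
  disjoint sets, and \<open>t\<close> whose powers move \<open>I\<close> to disjoint sets. The swindle writes \<open>h\<^sub>j\<close> as a
  commutator of some \<open>K\<^sub>j\<close> with \<open>s\<close>, and a single \<open>F\<close> acting as \<open>K\<^sub>j\<close> on the \<open>j\<close>-th copy of \<open>I\<close>
  yields every \<open>h\<^sub>j\<close> as the commutator of \<open>t\<^sup>-\<^sup>j F t\<^sup>j\<close> with \<open>s\<close>. The letters are \<open>s\<close>, \<open>t\<close>, \<open>d\<close>, \<open>F\<close>
  and their inverses.
\<close>

text \<open>\<open>HOL-Algebra\<close> claims the notation \<open>inv\<close>.\<close>

abbreviation inv_fun :: "(rat \<Rightarrow> rat) \<Rightarrow> rat \<Rightarrow> rat" where
  "inv_fun f \<equiv> inv_into UNIV f"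

section \<open>Order automorphisms of the rationals with prescribed support\<close>

definition Aut_on :: "rat set \<Rightarrow> (rat \<Rightarrow> rat) set" where
  "Aut_on W = {f. bij f \<and> strict_mono f \<and> (\<forall>x. x \<notin> W \<longrightarrow> f x = x)}"

lemma Aut_on_UNIV: "carrier Aut_rat = Aut_on UNIV"
proof -
  have "strict_mono f" if "\<And>x y. x \<le> y \<longleftrightarrow> f x \<le> f y" for f :: "rat \<Rightarrow> rat"
    using that by (metis strict_monoI not_le)
  then show ?thesis
    unfolding Aut_rat_def Aut_on_def by (auto simp: strict_mono_less_eq)
qed

lemma Aut_onI: "surj f \<Longrightarrow> strict_mono f \<Longrightarrow> (\<And>x. x \<notin> W \<Longrightarrow> f x = x) \<Longrightarrow> f \<in> Aut_on W"
  by (auto simp: Aut_on_def bij_def strict_mono_imp_inj_on)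

lemma Aut_onD:
  assumes "f \<in> Aut_on W"
  shows "bij f" "strict_mono f" "x \<notin> W \<Longrightarrow> f x = x"
  using assms by (auto simp: Aut_on_def)

lemma Aut_on_inv [simp]:
  assumes "f \<in> Aut_on W"
  shows "inv_fun f (f x) = x" "f (inv_fun f x) = x"
  using Aut_onD(1)[OF assms] by (auto simp: bij_is_inj bij_is_surj surj_f_inv_f)

lemma Aut_on_less_iff:
  assumes "f \<in> Aut_on W"
  shows "f x < f y \<longleftrightarrow> x < y" "f x \<le> f y \<longleftrightarrow> x \<le> y"
  using Aut_onD(2)[OF assms] by (simp_all add: strict_mono_less strict_mono_less_eq)

lemma Aut_on_mono: "f \<in> Aut_on V \<Longrightarrow> V \<subseteq> W \<Longrightarrow> f \<in> Aut_on W"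
  by (auto simp: Aut_on_def)

lemma Aut_on_UNIV_I: "f \<in> Aut_on W \<Longrightarrow> f \<in> Aut_on UNIV"
  by (erule Aut_on_mono) simp

lemma id_Aut_on: "id \<in> Aut_on W" "(\<lambda>x. x) \<in> Aut_on W"
  using bij_id by (auto simp: Aut_on_def strict_mono_def id_def)

lemma inv_Aut_on: assumes "f \<in> Aut_on W" shows "inv_fun f \<in> Aut_on W"
proof (rule Aut_onI)
  show "surj (inv_fun f)" using Aut_onD(1)[OF assms] by (simp add: bij_imp_bij_inv bij_is_surj)
  show "strict_mono (inv_fun f)"
  proof (rule strict_monoI)
    fix x y :: rat assume "x < y"
    then show "inv_fun f x < inv_fun f y"
      using Aut_on_less_iff(1)[OF assms, of "inv_fun f x" "inv_fun f y"] assms by simp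
  qed
  show "inv_fun f x = x" if "x \<notin> W" for x
    using Aut_onD(3)[OF assms that] Aut_on_inv(1)[OF assms, of x] by simp
qed

lemma comp_Aut_on: "f \<in> Aut_on W \<Longrightarrow> g \<in> Aut_on W \<Longrightarrow> f \<circ> g \<in> Aut_on W"
  by (auto simp: Aut_on_def bij_comp strict_mono_def)

lemma funpow_Aut_on: "f \<in> Aut_on W \<Longrightarrow> f ^^ n \<in> Aut_on W"
  by (induction n) (auto simp: id_Aut_on comp_Aut_on)

lemma inv_funpow_Aut_on:
  assumes "f \<in> Aut_on W"
  shows "(inv_fun f ^^ n) ((f ^^ n) x) = x" "(f ^^ n) ((inv_fun f ^^ n) x) = x"
proof -
  have "inv_fun f ^^ n = inv_fun (f ^^ n)" using Aut_onD(1)[OF assms] by (simp add: inv_fn)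
  then show "(inv_fun f ^^ n) ((f ^^ n) x) = x" "(f ^^ n) ((inv_fun f ^^ n) x) = x"
    using Aut_on_inv[OF funpow_Aut_on[OF assms]] by simp_all
qed

text \<open>A point \<open>x\<close> of \<open>W\<close> sent outside \<open>W\<close> would have a
  fixed image, and injectivity would then force \<open>f x = x\<close>.\<close>

lemma Aut_on_closed:
  assumes "f \<in> Aut_on W" shows "f x \<in> W \<longleftrightarrow> x \<in> W"
proof -
  have "f x \<in> W" if "x \<in> W"
  proof (rule ccontr)
    assume n: "f x \<notin> W"
    then have "f (f x) = f x" using Aut_onD(3)[OF assms] by simp
    then have "f x = x" using assms Aut_on_inv(1)[OF assms] by metis
    with n that show False by simp
  qed
  then show ?thesis using Aut_onD(3)[OF assms] by metis
qed

lemma conj_Aut_on: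
  assumes u: "u \<in> Aut_on V" and h: "h \<in> Aut_on W"
  shows "u \<circ> h \<circ> inv_fun u \<in> Aut_on (u ` W)"
proof -
  have "u \<circ> h \<circ> inv_fun u \<in> Aut_on UNIV"
    using u h by (intro comp_Aut_on inv_Aut_on) (auto intro: Aut_on_UNIV_I)
  moreover have "(u \<circ> h \<circ> inv_fun u) x = x" if "x \<notin> u ` W" for x
  proof -
    have "inv_fun u x \<notin> W" using that Aut_on_inv(2)[OF u, of x] by (metis imageI)
    then show ?thesis using Aut_onD(3)[OF h] u by simp
  qed
  ultimately show ?thesis by (simp add: Aut_on_def)
qed

section \<open>Gluing automorphisms with disjoint supports\<close>

text \<open>The supports are left out of the body: when they are disjoint, at most one piece moves a
  given point, so \<open>SOME\<close> has no real choice.\<close>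

definition glue :: "('j \<Rightarrow> rat \<Rightarrow> rat) \<Rightarrow> rat \<Rightarrow> rat" where
  "glue g x = (if \<exists>j. g j x \<noteq> x then g (SOME j. g j x \<noteq> x) x else x)"

context
  fixes g :: "'j \<Rightarrow> rat \<Rightarrow> rat" and A :: "'j \<Rightarrow> rat set"
  assumes g: "\<And>j. g j \<in> Aut_on (A j)" and disj: "disjoint_family A"
begin

lemma glue_in: assumes "x \<in> A j" shows "glue g x = g j x"
proof -
  have eq: "k = j" if "g k x \<noteq> x" for k
  proof -
    have "x \<in> A k" using that Aut_onD(3)[OF g] by blast
    then show ?thesis using assms disjoint_family_onD[OF disj, of k j] by blast
  qed
  show ?thesis
  proof (cases "g j x = x")
    case True
    then have "\<nexists>k. g k x \<noteq> x" using eq by blast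
    then show ?thesis using True by (simp add: glue_def)
  next
    case False
    then have "(SOME k. g k x \<noteq> x) = j" by (intro some_equality eq) auto
    then show ?thesis using False by (auto simp: glue_def)
  qed
qed

lemma glue_notin: assumes "\<And>j. x \<notin> A j" shows "glue g x = x"
  using assms Aut_onD(3)[OF g] by (auto simp: glue_def)

text \<open>Any two points lie in at most two of the supports, where the glued map is a composition of
  two of its pieces.\<close>

lemma glue_Aut_on: "glue g \<in> Aut_on (\<Union>j. A j)"
proof (rule Aut_onI)
  show "glue g x = x" if "x \<notin> (\<Union>j. A j)" for x using that by (intro glue_notin) auto
  show "surj (glue g)"
  proof (unfold surj_def, rule allI)
    fix y
    show "\<exists>x. y = glue g x"
    proof (cases "\<exists>j. y \<in> A j")
      case True
      then obtain j where j: "y \<in> A j" ..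
      then have "inv_fun (g j) y \<in> A j" using Aut_on_closed[OF inv_Aut_on[OF g]] by blast
      then show ?thesis using glue_in Aut_on_inv(2)[OF g] by metis
    next
      case False then show ?thesis using glue_notin by metis
    qed
  qed
  show "strict_mono (glue g)"
  proof (rule strict_monoI)
    fix x y :: rat assume xy: "x < y"
    have "\<exists>u \<in> Aut_on UNIV. u x = glue g x \<and> u y = glue g y"
    proof (cases "\<exists>j. x \<in> A j")
      case True
      then obtain j where j: "x \<in> A j" ..
      show ?thesis
      proof (cases "\<exists>k. y \<in> A k \<and> k \<noteq> j")
        case True
        then obtain k where k: "y \<in> A k" "k \<noteq> j" by blast
        then have d: "A j \<inter> A k = {}" using disj by (auto simp: disjoint_family_on_def)
        have "g k y \<in> A k" using k Aut_on_closed[OF g] by blast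
        then have "g k x = x" "g j (g k y) = g k y"
          using j d Aut_onD(3)[OF g] by (meson disjoint_iff)+
        then have "(g j \<circ> g k) x = glue g x" "(g j \<circ> g k) y = glue g y"
          using glue_in[OF j] glue_in[OF k(1)] by simp_all
        then show ?thesis using g by (meson Aut_on_UNIV_I comp_Aut_on)
      next
        case False
        have "g j y = glue g y"
        proof (cases "y \<in> A j")
          case nj: False
          then have "glue g y = y" using False by (intro glue_notin) blast
          then show ?thesis using Aut_onD(3)[OF g nj] by simp
        qed (simp add: glue_in)
        then show ?thesis using glue_in[OF j] Aut_on_UNIV_I[OF g, of j] by auto
      qed
    next
      case False
      then have x: "glue g x = x" "\<And>j. g j x = x" using glue_notin Aut_onD(3)[OF g] by blast+
      show ?thesis
      proof (cases "\<exists>k. y \<in> A k")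
        case True
        then obtain k where k: "y \<in> A k" ..
        then show ?thesis using x glue_in[OF k] Aut_on_UNIV_I[OF g, of k] by auto
      next
        case False
        then have "glue g y = y" using glue_notin by blast
        then show ?thesis using x by (intro bexI[OF _ id_Aut_on(1)]) auto
      qed
    qed
    then show "glue g x < glue g y" using xy Aut_on_less_iff(1) by metis
  qed
qed

end

section \<open>Piecewise affine constructions\<close>

lemma affine_Aut:
  fixes a b c :: rat
  assumes "c > 0"
  shows "(\<lambda>x. b + (x - a) * c) \<in> Aut_on UNIV"
proof (rule Aut_onI)
  show "surj (\<lambda>x. b + (x - a) * c)"
  proof (rule surjI)
    show "b + ((a + (y - b) / c) - a) * c = y" for y using assms by simp
  qed
  show "strict_mono (\<lambda>x. b + (x - a) * c)" using assms by (auto simp: strict_mono_def)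
qed simp

lemma affine_Aut_through:
  fixes a b a' b' :: rat
  assumes "a < a'" "b < b'"
  obtains f where "f \<in> Aut_on UNIV" "f a = b" "f a' = b'"
proof
  show "(\<lambda>x. b + (x - a) * ((b' - b) / (a' - a))) \<in> Aut_on UNIV"
    using assms by (rule_tac affine_Aut) simp
qed (use assms in auto)

lemma patch_Aut:
  assumes f: "f \<in> Aut_on UNIV" and g: "g \<in> Aut_on UNIV" and eq: "f p = g p"
  shows "(\<lambda>x. if x \<le> p then f x else g x) \<in> Aut_on UNIV" (is "?h \<in> _")
proof (rule Aut_onI)
  show "strict_mono ?h"
  proof (rule strict_monoI)
    fix x y :: rat assume xy: "x < y"
    show "?h x < ?h y"
    proof (cases "x \<le> p \<and> \<not> y \<le> p")
      case True
      then have "f x \<le> f p" "g p < g y" using Aut_on_less_iff[OF f] Aut_on_less_iff[OF g] by auto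
      then show ?thesis using True eq by auto
    next
      case False
      then show ?thesis using xy Aut_on_less_iff[OF f] Aut_on_less_iff[OF g] by auto
    qed
  qed
  show "surj ?h"
  proof (unfold surj_def, rule allI)
    fix y
    show "\<exists>x. y = ?h x"
    proof (cases "y \<le> f p")
      case True
      then have "inv_fun f y \<le> p" using Aut_on_less_iff[OF f, of "inv_fun f y" p] f by simp
      then show ?thesis using f by (intro exI[of _ "inv_fun f y"]) simp
    next
      case False
      then have "\<not> inv_fun g y \<le> p" using Aut_on_less_iff[OF g, of "inv_fun g y" p] g eq by simp
      then show ?thesis using g by (intro exI[of _ "inv_fun g y"]) simp
    qed
  qed
qed simp

text \<open>The graph of \<open>f\<close> over the segment from \<open>u\<close> to \<open>v\<close>
  is joined to the fixed points \<open>l\<close> and \<open>r\<close> by two affine pieces and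
  continued by the identity. With \<open>u = v\<close> this prescribes a single value, as in the
  construction of shifts.\<close>

lemma extend_Aut_on:
  fixes l r u v :: rat
  assumes f: "f \<in> Aut_on UNIV" and "l < u" "u \<le> v" "v < r" "l < f u" "f v < r"
  obtains h where "h \<in> Aut_on {l<..<r}" "\<And>x. u \<le> x \<Longrightarrow> x \<le> v \<Longrightarrow> h x = f x"
proof -
  obtain a where a: "a \<in> Aut_on UNIV" "a l = l" "a u = f u"
    using affine_Aut_through[of l u l "f u"] assms by blast
  obtain b where b: "b \<in> Aut_on UNIV" "b v = f v" "b r = r"
    using affine_Aut_through[of v r "f v" r] assms by blast
  define h1 where "h1 = (\<lambda>x. if x \<le> l then id x else a x)"
  define h2 where "h2 = (\<lambda>x. if x \<le> u then h1 x else f x)"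
  define h3 where "h3 = (\<lambda>x. if x \<le> v then h2 x else b x)"
  define h4 where "h4 = (\<lambda>x. if x \<le> r then h3 x else id x)"
  have h1: "h1 \<in> Aut_on UNIV" unfolding h1_def using a id_Aut_on by (rule_tac patch_Aut) auto
  have h2: "h2 \<in> Aut_on UNIV" unfolding h2_def
    using a f h1 assms by (rule_tac patch_Aut) (auto simp: h1_def)
  have h3: "h3 \<in> Aut_on UNIV" unfolding h3_def
    using a b f h2 assms by (rule_tac patch_Aut) (auto simp: h1_def h2_def)
  have h4: "h4 \<in> Aut_on UNIV" unfolding h4_def
    using b h3 id_Aut_on assms by (rule_tac patch_Aut) (auto simp: h3_def)
  show thesis
  proof
    have "h4 x = x" if "x \<notin> {l<..<r}" for x
      using that assms b by (auto simp: h1_def h2_def h3_def h4_def)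
    with h4 show "h4 \<in> Aut_on {l<..<r}" by (simp add: Aut_on_def)
    show "h4 x = f x" if "u \<le> x" "x \<le> v" for x
      using that assms a by (auto simp: h1_def h2_def h3_def h4_def)
  qed
qed

subsection \<open>Recovering a sequence of automorphisms from a single one\<close>

text \<open>When \<open>a < b\<close>, the interval is a fundamental domain for \<open>s\<close>: a
  positive power of \<open>s\<close> sends \<open>a\<close> to at least \<open>b\<close>, hence the
  whole interval to the right of \<open>b\<close>.\<close>

lemma disjoint_images_funpow:
  fixes s :: "rat \<Rightarrow> rat"
  assumes s: "s \<in> Aut_on V" and ab: "s a = b"
  shows "disjoint_family (\<lambda>n. (s ^^ n) ` {a<..<b})"
proof -
  have less: False
    if "m < n" "a < x" "x < b" "a < y" "y < b" "(s ^^ m) x = (s ^^ n) y" for m n x y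
  proof -
    obtain k where k: "n = m + Suc k" using \<open>m < n\<close> less_iff_Suc_add by auto
    have "(s ^^ m) x = (s ^^ m) ((s ^^ Suc k) y)" using that(6) unfolding k by (simp only: funpow_add comp_apply)
    then have x: "x = (s ^^ Suc k) y" using inv_funpow_Aut_on(1)[OF s] by metis
    have "a < b" using that by linarith
    have "b \<le> (s ^^ Suc j) a" for j
    proof (induction j)
      case (Suc j)
      have "s a \<le> s b" "s b \<le> s ((s ^^ Suc j) a)"
        using Suc \<open>a < b\<close> Aut_on_less_iff(2)[OF s] by auto
      then show ?case using ab by simp
    qed (simp add: ab)
    then have "b \<le> (s ^^ Suc k) a" .
    also have "\<dots> < x" unfolding x using Aut_on_less_iff(1)[OF funpow_Aut_on[OF s]] that by blast
    finally show False using that by simp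
  qed
  have "(s ^^ m) ` {a<..<b} \<inter> (s ^^ n) ` {a<..<b} = {}" if "m \<noteq> n" for m n
  proof -
    have False if "a < x" "x < b" "a < y" "y < b" "(s ^^ m) x = (s ^^ n) y" for x y
      using less[of m n x y] less[of n m y x] that \<open>m \<noteq> n\<close> by linarith
    then show ?thesis by (force simp: disjoint_iff)
  qed
  then show ?thesis unfolding disjoint_family_on_def by blast
qed

text \<open>An infinite swindle: gluing \<open>s\<^sup>n h s\<^sup>-\<^sup>n\<close> for all \<open>n \<ge> 0\<close> gives \<open>K\<close> with \<open>h\<close> the commutator of
  \<open>K\<close> and \<open>s\<close>.\<close>

lemma swindle:
  assumes s: "s \<in> Aut_on I" and WI: "W \<subseteq> I" and disj: "disjoint_family (\<lambda>n. (s ^^ n) ` W)"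
    and h: "h \<in> Aut_on W"
  obtains K where "K \<in> Aut_on I" "\<And>x. K (s x) = h (s (K x))"
proof -
  define g where "g n = (s ^^ n) \<circ> h \<circ> inv_fun (s ^^ n)" for n
  have g: "g n \<in> Aut_on ((s ^^ n) ` W)" for n
    unfolding g_def by (rule conj_Aut_on[OF funpow_Aut_on[OF s] h])
  have gs: "g n ((s ^^ n) x) = (s ^^ n) (h x)" for n x
    using Aut_on_inv(1)[OF funpow_Aut_on[OF s]] by (simp add: g_def)
  have K: "glue g \<in> Aut_on (\<Union>n. (s ^^ n) ` W)" by (rule glue_Aut_on[OF g disj])
  have Ks: "glue g ((s ^^ n) x) = (s ^^ n) (h x)" if "x \<in> W" for n x
    using glue_in[OF g disj] that gs by (metis imageI)
  have Kn: "glue g x = x" if "\<And>n. x \<notin> (s ^^ n) ` W" for x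
    using Aut_onD(3)[OF K] that by blast
  have inW: "h y \<in> W \<longleftrightarrow> y \<in> W" for y using Aut_on_closed[OF h] by blast
  show thesis
  proof
    have "(s ^^ n) ` W \<subseteq> I" for n using WI Aut_on_closed[OF funpow_Aut_on[OF s]] by blast
    then show "glue g \<in> Aut_on I" using K by (rule_tac Aut_on_mono[OF K]) blast
    show "glue g (s x) = h (s (glue g x))" for x
    proof (cases "\<exists>n. x \<in> (s ^^ n) ` W")
      case True
      then obtain n y where y: "y \<in> W" "x = (s ^^ n) y" by blast
      \<comment> \<open>\<open>h\<close> is trivial on the higher copies of \<open>W\<close>. A
        factor \<open>h\<close> appears only when \<open>s\<close> enters \<open>W\<close> itself,
        from a point outside all copies.\<close>
      have "(s ^^ Suc n) (h y) \<notin> W"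
        using disjoint_family_onD[OF disj, of 0 "Suc n"] y inW by (auto simp: disjoint_iff)
      then show ?thesis using Ks[of y n] Ks[of y "Suc n"] y Aut_onD(3)[OF h] by simp
    next
      case False
      then have x: "glue g x = x" using Kn by blast
      show ?thesis
      proof (cases "s x \<in> W")
        case True then show ?thesis using Ks[of "s x" 0] x by simp
      next
        case nW: False
        have "s x \<notin> (s ^^ n) ` W" for n
        proof (cases n)
          case (Suc m)
          show ?thesis
          proof
            assume "s x \<in> (s ^^ n) ` W"
            then obtain y where "y \<in> W" "s x = s ((s ^^ m) y)" using Suc by auto
            then have "x = (s ^^ m) y" using Aut_on_inv(1)[OF s] by metis
            with \<open>y \<in> W\<close> False show False by blast
          qed
        qed (use nW in simp)
        then show ?thesis using Kn[of "s x"] nW x Aut_onD(3)[OF h] by auto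
      qed
    qed
  qed
qed

text \<open>Conjugated back by the \<open>j\<close>-th power of \<open>t\<close>, \<open>F\<close>
  acts on \<open>I\<close> as \<open>K j\<close>, so there its commutator with \<open>s\<close> is
  \<open>h j\<close> by the swindle. Off \<open>I\<close> this conjugate may be nontrivial, but it
  preserves the complement of \<open>I\<close>, where \<open>s\<close> is the identity, so the
  commutator is trivial.\<close>

lemma encode_sequence:
  fixes h :: "nat \<Rightarrow> rat \<Rightarrow> rat"
  assumes s: "s \<in> Aut_on I" and t: "t \<in> Aut_on V" and WI: "W \<subseteq> I"
    and dW: "disjoint_family (\<lambda>n. (s ^^ n) ` W)" and dI: "disjoint_family (\<lambda>n. (t ^^ n) ` I)"
    and h: "\<And>j. h j \<in> Aut_on W"
  obtains F where "F \<in> Aut_on UNIV"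
    "\<And>j. (inv_fun t ^^ j) \<circ> F \<circ> (t ^^ j) \<circ> s \<circ> (inv_fun t ^^ j) \<circ> inv_fun F \<circ> (t ^^ j) \<circ> inv_fun s = h j"
proof -
  have "\<exists>K. K \<in> Aut_on I \<and> (\<forall>x. K (s x) = h j (s (K x)))" for j
    using swindle[OF s WI dW h] by metis
  then obtain K where K: "\<And>j. K j \<in> Aut_on I" and Ks: "\<And>j x. K j (s x) = h j (s (K j x))"
    by metis
  define g where "g n = (t ^^ n) \<circ> K n \<circ> inv_fun (t ^^ n)" for n
  have g: "g n \<in> Aut_on ((t ^^ n) ` I)" for n
    unfolding g_def by (rule conj_Aut_on[OF funpow_Aut_on[OF t] K])
  define F where "F = glue g"
  have F: "F \<in> Aut_on UNIV"
    unfolding F_def by (rule Aut_on_UNIV_I[OF glue_Aut_on[OF g dI]])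
  have FI: "F ((t ^^ n) x) = (t ^^ n) (K n x)" if "x \<in> I" for n x
  proof -
    have "F ((t ^^ n) x) = g n ((t ^^ n) x)" unfolding F_def by (rule glue_in[OF g dI]) (use that in simp)
    also have "\<dots> = (t ^^ n) (K n x)" using Aut_on_inv(1)[OF funpow_Aut_on[OF t]] by (simp add: g_def)
    finally show ?thesis .
  qed
  have eq: "((inv_fun t ^^ j) \<circ> F \<circ> (t ^^ j) \<circ> s \<circ> (inv_fun t ^^ j) \<circ> inv_fun F \<circ> (t ^^ j) \<circ> inv_fun s) x = h j x"
    for j x
  proof -
    \<comment> \<open>The preimage of \<open>inv_fun s x\<close> under the conjugate of
      \<open>F\<close>; it remains to apply that conjugate to \<open>s y\<close>.\<close>
    define y where "y = (inv_fun t ^^ j) (inv_fun F ((t ^^ j) (inv_fun s x)))"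
    have Fy: "F ((t ^^ j) y) = (t ^^ j) (inv_fun s x)"
      unfolding y_def using inv_funpow_Aut_on(2)[OF t] F by simp
    have sI: "inv_fun s x \<in> I \<longleftrightarrow> x \<in> I" using Aut_on_closed[OF inv_Aut_on[OF s]] .
    have lhs: "((inv_fun t ^^ j) \<circ> F \<circ> (t ^^ j) \<circ> s \<circ> (inv_fun t ^^ j) \<circ> inv_fun F \<circ> (t ^^ j) \<circ> inv_fun s) x
      = (inv_fun t ^^ j) (F ((t ^^ j) (s y)))" by (simp add: y_def)
    show ?thesis
    proof (cases "x \<in> I")
      case True
      define z where "z = inv_fun (K j) (inv_fun s x)"
      have z: "z \<in> I" using Aut_on_closed[OF inv_Aut_on[OF K]] True sI by (simp add: z_def)
      have Kz: "K j z = inv_fun s x" using Aut_on_inv(2)[OF K] by (simp add: z_def)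
      have "F ((t ^^ j) z) = F ((t ^^ j) y)" using FI[OF z] Kz Fy by simp
      then have yz: "y = z" using Aut_on_inv(1)[OF F] inv_funpow_Aut_on(1)[OF t] by metis
      have "s z \<in> I" using z Aut_on_closed[OF s] by blast
      then have "F ((t ^^ j) (s y)) = (t ^^ j) (K j (s z))" using FI yz by simp
      then show ?thesis
        unfolding lhs using Ks Kz s inv_funpow_Aut_on(1)[OF t] by simp
    next
      case False
      then have x: "inv_fun s x = x" "h j x = x"
        using Aut_onD(3)[OF inv_Aut_on[OF s]] Aut_onD(3)[OF h] WI by auto
      have "y \<notin> I"
      proof
        assume "y \<in> I"
        then have "(t ^^ j) (K j y) = (t ^^ j) x" using FI Fy x by simp
        then have "K j y = x" using inv_funpow_Aut_on(1)[OF t] by metis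
        then show False using Aut_on_closed[OF K] \<open>y \<in> I\<close> False by metis
      qed
      then have "s y = y" using Aut_onD(3)[OF s] by blast
      then show ?thesis unfolding lhs using Fy x inv_funpow_Aut_on(1)[OF t] by simp
    qed
  qed
  show thesis using F eq by (intro that[of F]) (auto simp: fun_eq_iff)
qed

subsection \<open>Periodic automorphisms and a dilation\<close>

text \<open>For \<open>A\<close> inside the unit interval, the union of all integer translates of
  \<open>A\<close>.\<close>

definition cells :: "rat set \<Rightarrow> rat set" where
  "cells A = {x. frac x \<in> A}"

definition periodic :: "(rat \<Rightarrow> rat) \<Rightarrow> rat \<Rightarrow> rat" where
  "periodic g x = of_int \<lfloor>x\<rfloor> + g (frac x)"

context
  fixes g :: "rat \<Rightarrow> rat"
  assumes g: "g \<in> Aut_on {0<..<1}"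
begin

lemma unit_interval_bounds: "0 \<le> g (frac x)" "g (frac x) < 1"
proof -
  have "frac x = 0 \<or> frac x \<in> {0<..<1}" using frac_ge_0[of x] frac_lt_1[of x] by auto
  then have "g (frac x) = 0 \<or> g (frac x) \<in> {0<..<1}"
  proof
    assume "frac x = 0"
    then have "g (frac x) = 0" using Aut_onD(3)[OF g, of 0] by (simp del: frac_eq_0_iff)
    then show ?thesis ..
  next
    assume "frac x \<in> {0<..<1}"
    then show ?thesis using Aut_on_closed[OF g, of "frac x"] by blast
  qed
  then show "0 \<le> g (frac x)" "g (frac x) < 1" by auto
qed

lemma floor_periodic: "\<lfloor>periodic g x\<rfloor> = \<lfloor>x\<rfloor>"
  unfolding periodic_def using unit_interval_bounds[of x] by (intro floor_unique) auto

lemma frac_periodic: "frac (periodic g x) = g (frac x)"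
  using floor_periodic[of x] by (simp add: frac_def[of "periodic g x"]) (simp add: periodic_def)

lemma frac_funpow_periodic: "frac ((periodic g ^^ n) x) = (g ^^ n) (frac x)"
  by (induction n) (simp_all add: frac_periodic)

end

text \<open>The floor is preserved, so two points are compared either inside one cell, by
  \<open>g\<close>, or by their cells alone.\<close>

lemma periodic_Aut_on:
  assumes g: "g \<in> Aut_on A" and A: "A \<subseteq> {0<..<1}"
  shows "periodic g \<in> Aut_on (cells A)"
proof (rule Aut_onI)
  note g' = Aut_on_mono[OF g A]
  show "periodic g x = x" if "x \<notin> cells A" for x
    using that Aut_onD(3)[OF g, of "frac x"] by (simp add: cells_def periodic_def frac_def)
  show "surj (periodic g)"
  proof (rule surjI)
    show "periodic g (periodic (inv_fun g) y) = y" for y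
      using floor_periodic[OF inv_Aut_on[OF g'], of y] frac_periodic[OF inv_Aut_on[OF g'], of y] g
      by (simp add: periodic_def[of g]) (simp add: frac_def)
  qed
  show "strict_mono (periodic g)"
  proof (rule strict_monoI)
    fix x y :: rat assume xy: "x < y"
    show "periodic g x < periodic g y"
    proof (cases "\<lfloor>x\<rfloor> = \<lfloor>y\<rfloor>")
      case True
      then have "frac x < frac y" using xy by (simp add: frac_def)
      then show ?thesis using True Aut_on_less_iff(1)[OF g] by (simp add: periodic_def)
    next
      case False
      then have "\<lfloor>periodic g x\<rfloor> < \<lfloor>periodic g y\<rfloor>"
        using xy floor_periodic[OF g'] floor_mono[of x y] by simp
      then show ?thesis by (meson floor_mono not_le)
    qed
  qed
qed

text \<open>One bump carrying \<open>a\<close> to \<open>b\<close> inside the interval from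
  \<open>l\<close> to \<open>r\<close> is repeated in every unit cell.\<close>

lemma periodic_shift:
  fixes l a b r :: rat
  assumes "0 \<le> l" "l < a" "a < b" "b < r" "r \<le> 1"
  obtains s where "s \<in> Aut_on (cells {l<..<r})" "disjoint_family (\<lambda>n. (s ^^ n) ` cells {a<..<b})"
proof -
  obtain f where f: "f \<in> Aut_on UNIV" "f a = b" "f (a + 1) = b + 1"
    using affine_Aut_through[of a "a + 1" b "b + 1"] by auto
  obtain g where g: "g \<in> Aut_on {l<..<r}" "\<And>x. a \<le> x \<Longrightarrow> x \<le> a \<Longrightarrow> g x = f x"
    using extend_Aut_on[OF f(1), of l a a r] f(2) assms by auto
  have lr: "{l<..<r} \<subseteq> {0<..<1}" using assms by auto
  note g' = Aut_on_mono[OF g(1) lr]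
  have disj: "disjoint_family (\<lambda>n. (g ^^ n) ` {a<..<b})"
    by (rule disjoint_images_funpow[OF g(1)]) (use g(2)[of a] f(2) in simp)
  \<comment> \<open>A common point of two images would have one fractional part, so disjointness
    reduces to the single bump \<open>g\<close>.\<close>
  have sub: "frac ` ((periodic g ^^ n) ` cells {a<..<b}) \<subseteq> (g ^^ n) ` {a<..<b}" for n
    using frac_funpow_periodic[OF g'] by (auto simp: cells_def)
  have "disjoint_family (\<lambda>n. (periodic g ^^ n) ` cells {a<..<b})"
    unfolding disjoint_family_on_def
  proof (intro ballI impI)
    fix m n :: nat assume "m \<noteq> n"
    then have "(g ^^ m) ` {a<..<b} \<inter> (g ^^ n) ` {a<..<b} = {}"
      using disj by (simp add: disjoint_family_on_def)
    then have "frac ` ((periodic g ^^ m) ` cells {a<..<b}) \<inter> frac ` ((periodic g ^^ n) ` cells {a<..<b}) = {}"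
      using sub[of m] sub[of n] by blast
    then show "(periodic g ^^ m) ` cells {a<..<b} \<inter> (periodic g ^^ n) ` cells {a<..<b} = {}"
      by blast
  qed
  then show thesis using that periodic_Aut_on[OF g(1) lr] by blast
qed

text \<open>The segment from 1/4 to 3/4 is stretched onto the one from -1/4 to 5/4, which meets both
  translations. The shift 1/2 is half the period of the cells, so outside the middle even and odd
  powers are in opposite phase.\<close>

lemma dilation_exists:
  obtains d :: "rat \<Rightarrow> rat" where "d \<in> Aut_on UNIV"
    "\<And>x. 3/4 \<le> x \<Longrightarrow> d x = x + 1/2" "\<And>x. x \<le> 1/4 \<Longrightarrow> d x = x - 1/2"
proof -
  have tr: "(\<lambda>x::rat. x + b) \<in> Aut_on UNIV" for b
    using affine_Aut[of 1 b 0] by (simp add: add.commute)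
  obtain m :: "rat \<Rightarrow> rat" where m: "m \<in> Aut_on UNIV" "m (1/4) = -1/4" "m (3/4) = 5/4"
    using affine_Aut_through[of "1/4" "3/4" "-1/4" "5/4"] by auto
  define e where "e = (\<lambda>x::rat. if x \<le> 1/4 then x + (-1/2) else m x)"
  define d where "d = (\<lambda>x::rat. if x \<le> 3/4 then e x else x + 1/2)"
  have e: "e \<in> Aut_on UNIV" unfolding e_def by (rule patch_Aut[OF tr m(1)]) (simp add: m)
  have "d \<in> Aut_on UNIV" unfolding d_def
    by (rule patch_Aut[OF e tr]) (simp add: m e_def)
  then show thesis
  proof (rule that)
    show "d x = x + 1/2" if "3/4 \<le> x" for x
    proof (cases "x = 3/4")
      case True then show ?thesis unfolding True d_def e_def by (simp add: m(3))
    next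
      case False then show ?thesis using that by (simp add: d_def)
    qed
    show "d x = x - 1/2" if "x \<le> 1/4" for x using that by (simp add: d_def e_def)
  qed
qed

section \<open>Splitting an automorphism into two factors with prescribed supports\<close>

context
  fixes d :: "rat \<Rightarrow> rat"
  assumes d: "d \<in> Aut_on UNIV"
    and d_right: "\<And>x. 3/4 \<le> x \<Longrightarrow> d x = x + 1/2"
    and d_left: "\<And>x. x \<le> 1/4 \<Longrightarrow> d x = x - 1/2"
begin

lemma dilation_funpow:
  "3/4 \<le> x \<Longrightarrow> (d ^^ n) x = x + of_nat n / 2"
  "x \<le> 1/4 \<Longrightarrow> (d ^^ n) x = x - of_nat n / 2"
proof (induction n)
  case (Suc n)
  have [simp]: "(0::rat) \<le> of_nat n" by simp
  { case 1
    have "3/4 \<le> x + of_nat n / 2" using 1 by (simp add: add_increasing2)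
    then have "d (x + of_nat n / 2) = x + of_nat n / 2 + 1/2" by (rule d_right)
    then show ?case using Suc(1)[OF 1] by (simp add: add_divide_distrib) }
  { case 2
    have "x - of_nat n / 2 \<le> 1/4" using 2 \<open>0 \<le> of_nat n\<close> by linarith
    then have "d (x - of_nat n / 2) = x - of_nat n / 2 - 1/2" by (rule d_left)
    then show ?case using Suc(2)[OF 2] by (simp add: add_divide_distrib) }
qed simp_all

text \<open>The gaps of \<open>cells {1/8<..<7/8}\<close> moved by \<open>d\<^sup>2\<^sup>N\<^sup>+\<^sup>1\<close> lie well inside the components of the same
  set moved by \<open>d\<^sup>2\<^sup>N\<close>, and outside the central component. So one factor copies \<open>f\<close> on these gaps,
  and nothing needs to be known about \<open>f\<close> in the middle.\<close>

lemma decompose: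
  fixes N :: nat
  assumes f: "f \<in> Aut_on UNIV" and near: "\<And>x. of_nat N \<le> \<bar>x\<bar> \<Longrightarrow> \<bar>f x - x\<bar> < 1/4"
  obtains a b where "a \<in> Aut_on ((d ^^ (2*N)) ` cells {1/8<..<7/8})"
    "b \<in> Aut_on ((d ^^ (2*N+1)) ` cells {1/8<..<7/8})" "f = a \<circ> b"
proof -
  let ?W = "cells {1/8<..<7/8::rat}"
  \<comment> \<open>The cell from \<open>j\<close> to \<open>j + 1\<close> then avoids both the
    points of absolute value below \<open>N\<close> and the stretched central component. Other
    indices receive the empty support, hence the identity.\<close>
  define far where "far j \<longleftrightarrow> int N + 1 \<le> j \<or> j \<le> - int N - 1" for j
  define C where "C j = (if far j then {of_int j + 1/8<..<of_int j + 7/8::rat} else {})" for j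
  have "\<exists>g. g \<in> Aut_on (C j) \<and> (far j \<longrightarrow>
    (\<forall>x. of_int j + 3/8 \<le> x \<and> x \<le> of_int j + 5/8 \<longrightarrow> g x = f x))" for j
  proof (cases "far j")
    case True
    then have "of_int (int N + 1) \<le> (of_int j :: rat) \<or> of_int j \<le> (of_int (- int N - 1) :: rat)"
      unfolding far_def of_int_le_iff .
    then have j: "of_nat N + 1 \<le> (of_int j :: rat) \<or> of_int j \<le> (- of_nat N - 1 :: rat)" by simp
    have "of_nat N \<le> \<bar>of_int j + 3/8 :: rat\<bar>" "of_nat N \<le> \<bar>of_int j + 5/8 :: rat\<bar>"
      using j by linarith+
    then have "\<bar>f (of_int j + 3/8) - (of_int j + 3/8)\<bar> < 1/4"
      "\<bar>f (of_int j + 5/8) - (of_int j + 5/8)\<bar> < 1/4" by (simp_all only: near)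
    \<comment> \<open>A displacement below 1/4 keeps the image of the segment from 3/8 to 5/8 of the
      cell strictly between its points 1/8 and 7/8, the room needed for the extension.\<close>
    then have "of_int j + 1/8 < f (of_int j + 3/8)" "f (of_int j + 5/8) < of_int j + 7/8"
      unfolding abs_less_iff by linarith+
    then obtain h where "h \<in> Aut_on {of_int j + 1/8<..<of_int j + 7/8}"
      "\<And>x. of_int j + 3/8 \<le> x \<Longrightarrow> x \<le> of_int j + 5/8 \<Longrightarrow> h x = f x"
      using extend_Aut_on[OF f, of "of_int j + 1/8" "of_int j + 3/8" "of_int j + 5/8" "of_int j + 7/8"]
      by auto
    then show ?thesis using True by (auto simp: C_def)
  next
    case False then show ?thesis using id_Aut_on by blast
  qed
  then obtain g where g: "\<And>j. g j \<in> Aut_on (C j)" and gf: "\<And>j x. far j \<Longrightarrow>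
    of_int j + 3/8 \<le> x \<Longrightarrow> x \<le> of_int j + 5/8 \<Longrightarrow> g j x = f x" by metis
  have floorC: "\<lfloor>x\<rfloor> = j" if "x \<in> C j" for x j
    using that by (intro floor_unique) (auto simp: C_def split: if_splits)
  then have disj: "disjoint_family C" unfolding disjoint_family_on_def by blast
  define a where "a = glue g"
  have a: "a \<in> Aut_on (\<Union>j. C j)" unfolding a_def by (rule glue_Aut_on[OF g disj])
  have af: "a x = f x" if "far j" "of_int j + 3/8 \<le> x" "x \<le> of_int j + 5/8" for j x
  proof -
    have "x \<in> C j" using that by (auto simp: C_def)
    then show ?thesis unfolding a_def using glue_in[OF g disj] gf that by metis
  qed
  have "C j \<subseteq> (d ^^ (2*N)) ` ?W" for j
  proof
    fix x assume x: "x \<in> C j"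
    then have j: "far j" and xj: "of_int j + 1/8 < x" "x < of_int j + 7/8"
      by (auto simp: C_def split: if_splits)
    \<comment> \<open>Beyond the middle, the power \<open>2*N\<close> of \<open>d\<close> translates
      by the integer \<open>N\<close>, so the preimage of \<open>x\<close> is again in
      \<open>?W\<close>.\<close>
    have W: "of_int k + x \<in> ?W" for k
    proof -
      have "\<lfloor>of_int k + x\<rfloor> = k + j" using floorC[OF x] by simp
      then show ?thesis using xj by (simp add: cells_def frac_def)
    qed
    from j consider "int N + 1 \<le> j" | "j \<le> - int N - 1" unfolding far_def by blast
    then show "x \<in> (d ^^ (2*N)) ` ?W"
    proof cases
      case 1
      then have "of_int (int N + 1) \<le> (of_int j :: rat)" unfolding of_int_le_iff .
      then have "(d ^^ (2*N)) (of_int (- int N) + x) = x"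
        using xj by (subst dilation_funpow) auto
      then show ?thesis using W by (metis imageI)
    next
      case 2
      then have "of_int j \<le> (of_int (- int N - 1) :: rat)" unfolding of_int_le_iff .
      then have "(d ^^ (2*N)) (of_int (int N) + x) = x"
        using xj by (subst dilation_funpow(2)) auto
      then show ?thesis using W by (metis imageI)
    qed
  qed
  then have a1: "a \<in> Aut_on ((d ^^ (2*N)) ` ?W)" by (intro Aut_on_mono[OF a]) blast
  have "inv_fun a \<circ> f \<in> Aut_on UNIV"
    by (rule comp_Aut_on[OF inv_Aut_on[OF Aut_on_UNIV_I[OF a]] f])
  moreover have "(inv_fun a \<circ> f) x = x" if x: "x \<notin> (d ^^ (2*N+1)) ` ?W" for x
  proof -
    define y where "y = (inv_fun d ^^ (2*N+1)) x"
    have xy: "x = (d ^^ (2*N+1)) y" using inv_funpow_Aut_on(2)[OF d] by (simp only: y_def)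
    then have "frac y \<notin> {1/8<..<7/8}" using x by (auto simp: cells_def)
    then have "frac y \<le> 1/8 \<or> 7/8 \<le> frac y" by auto
    \<comment> \<open>The complement of \<open>?W\<close> consists of the closed intervals of radius
      1/8 about the integers \<open>k\<close>.\<close>
    then obtain k where k: "of_int k - 1/8 \<le> y" "y \<le> of_int k + 1/8"
    proof
      assume "frac y \<le> 1/8"
      then have "of_int \<lfloor>y\<rfloor> - 1/8 \<le> y" "y \<le> of_int \<lfloor>y\<rfloor> + 1/8"
        using frac_ge_0[of y] unfolding frac_def by linarith+
      then show ?thesis by (rule that)
    next
      assume "7/8 \<le> frac y"
      then have "of_int (\<lfloor>y\<rfloor> + 1) - 1/8 \<le> y" "y \<le> of_int (\<lfloor>y\<rfloor> + 1) + 1/8"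
        using frac_lt_1[of y] unfolding frac_def of_int_add of_int_1 by linarith+
      then show ?thesis by (rule that)
    qed
    \<comment> \<open>The odd power translates the gap about \<open>k\<close> by
      \<open>N + 1/2\<close>, to the right if \<open>k\<close> is at least 1 and to the left
      otherwise. It lands between 3/8 and 5/8 of a far cell, where \<open>a\<close> copies
      \<open>f\<close>.\<close>
    have "a x = f x"
    proof (cases "1 \<le> k")
      case True
      then have "(of_int 1 :: rat) \<le> of_int k" unfolding of_int_le_iff .
      then have "x = y + of_nat N + 1/2"
        using k unfolding xy by (subst dilation_funpow) (auto simp: field_simps)
      then show ?thesis using True k by (intro af[of "k + int N"]) (auto simp: far_def)
    next
      case False
      then have "(of_int k :: rat) \<le> of_int 0" unfolding of_int_le_iff by simp
      then have "x = y - of_nat N - 1/2"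
        using k unfolding xy by (subst dilation_funpow(2)) (auto simp: field_simps)
      then show ?thesis using False k by (intro af[of "k - int N - 1"]) (auto simp: far_def)
    qed
    then show ?thesis using Aut_on_inv(1)[OF a, of x] by simp
  qed
  ultimately have "inv_fun a \<circ> f \<in> Aut_on ((d ^^ (2*N+1)) ` ?W)" by (simp add: Aut_on_def)
  moreover have "f = a \<circ> (inv_fun a \<circ> f)" using a by (simp add: fun_eq_iff)
  ultimately show thesis using that a1 by blast
qed

end

subsection \<open>Bounding the displacement by conjugation\<close>

text \<open>Affine interpolation between consecutive integers; that \<open>p\<close> is unbounded in
  both directions gives surjectivity.\<close>

lemma interpolate_Aut:
  fixes p :: "int \<Rightarrow> rat"
  assumes p: "strict_mono p" and above: "\<And>y. \<exists>k. y < p k" and below: "\<And>y. \<exists>k. p k \<le> y"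
  obtains c where "c \<in> Aut_on UNIV" "\<And>k. c (of_int k) = p k"
proof
  define c where "c x = p \<lfloor>x\<rfloor> + frac x * (p (\<lfloor>x\<rfloor> + 1) - p \<lfloor>x\<rfloor>)" for x :: rat
  have step: "p k < p (k + 1)" for k using p by (simp add: strict_mono_def)
  show "c (of_int k) = p k" for k by (simp add: c_def)
  show "c \<in> Aut_on UNIV"
  proof (rule Aut_onI)
    show "strict_mono c"
    proof (rule strict_monoI)
      fix x y :: rat assume xy: "x < y"
      show "c x < c y"
      proof (cases "\<lfloor>x\<rfloor> = \<lfloor>y\<rfloor>")
        case True
        then have "frac x < frac y" using xy by (simp add: frac_def)
        then show ?thesis using True step[of "\<lfloor>y\<rfloor>"] by (simp add: c_def)
      next
        case False
        then have "\<lfloor>x\<rfloor> + 1 \<le> \<lfloor>y\<rfloor>" using floor_mono[of x y] xy by linarith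
        then have "p (\<lfloor>x\<rfloor> + 1) \<le> p \<lfloor>y\<rfloor>" using p by (simp add: strict_mono_less_eq)
        moreover have "frac x * (p (\<lfloor>x\<rfloor> + 1) - p \<lfloor>x\<rfloor>) < 1 * (p (\<lfloor>x\<rfloor> + 1) - p \<lfloor>x\<rfloor>)"
          by (rule mult_strict_right_mono) (use frac_lt_1[of x] step[of "\<lfloor>x\<rfloor>"] in simp_all)
        moreover have "0 \<le> frac y * (p (\<lfloor>y\<rfloor> + 1) - p \<lfloor>y\<rfloor>)"
          by (rule mult_nonneg_nonneg) (use step[of "\<lfloor>y\<rfloor>"] in simp_all)
        ultimately show ?thesis by (simp add: c_def)
      qed
    qed
    show "surj c"
    proof (unfold surj_def, rule allI)
      fix y
      obtain a b where ab: "p a \<le> y" "y < p b" using above below by blast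
      have "\<exists>k. p k \<le> y \<and> y < p (k + 1)"
      proof (rule ccontr)
        \<comment> \<open>Otherwise induction would carry \<open>p k \<le> y\<close> from
          \<open>a\<close> up past \<open>b\<close>.\<close>
        assume n: "\<nexists>k. p k \<le> y \<and> y < p (k + 1)"
        have "p k \<le> y" if "a \<le> k" for k
          using that by (induction k rule: int_ge_induct) (use ab n not_less in blast)+
        then have "p (max a b) \<le> y" by simp
        moreover have "p b \<le> p (max a b)" using p by (simp add: strict_mono_less_eq)
        ultimately show False using ab by simp
      qed
      then obtain k where k: "p k \<le> y" "y < p (k + 1)" by blast
      define r where "r = (y - p k) / (p (k + 1) - p k)"
      have r: "0 \<le> r" "r < 1" "r * (p (k + 1) - p k) = y - p k"
        using k step[of k] by (simp_all add: r_def)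
      have "\<lfloor>of_int k + r\<rfloor> = k" using r by (intro floor_unique) auto
      then have "c (of_int k + r) = y" using r(3) by (simp add: c_def frac_def)
      then show "\<exists>x. y = c x" by metis
    qed
  qed simp
qed

text \<open>Only finitely many maps enter at each stage, and \<open>f i\<close> enters at every
  positive stage from \<open>i\<close> on, so one recursion serves the whole sequence. The sum is a
  crude maximum; the inverses limit inward motion.\<close>

fun radius :: "(nat \<Rightarrow> rat \<Rightarrow> rat) \<Rightarrow> nat \<Rightarrow> rat" where
  "radius f 0 = 0"
| "radius f (Suc k) = radius f k + 1 + (\<Sum>i\<le>Suc k.
     \<bar>f i (radius f k)\<bar> + \<bar>f i (- radius f k)\<bar>
     + \<bar>inv_fun (f i) (radius f k)\<bar> + \<bar>inv_fun (f i) (- radius f k)\<bar>)"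

lemma radius_Suc:
  "radius f k + 1 \<le> radius f (Suc k)"
  "0 \<le> radius f k"
  "i \<le> Suc k \<Longrightarrow> \<bar>f i (radius f k)\<bar> < radius f (Suc k)"
  "i \<le> Suc k \<Longrightarrow> \<bar>f i (- radius f k)\<bar> < radius f (Suc k)"
  "i \<le> Suc k \<Longrightarrow> \<bar>inv_fun (f i) (radius f k)\<bar> < radius f (Suc k)"
  "i \<le> Suc k \<Longrightarrow> \<bar>inv_fun (f i) (- radius f k)\<bar> < radius f (Suc k)"
proof -
  define g where "g i = \<bar>f i (radius f k)\<bar> + \<bar>f i (- radius f k)\<bar>
     + \<bar>inv_fun (f i) (radius f k)\<bar> + \<bar>inv_fun (f i) (- radius f k)\<bar>" for i
  have g0: "0 \<le> g i" for i by (simp add: g_def)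
  have Suc: "radius f (Suc k) = radius f k + 1 + sum g {..Suc k}" by (simp add: g_def)
  have gi: "g i \<le> sum g {..Suc k}" if "i \<le> Suc k" using that g0 by (intro member_le_sum) auto
  show nonneg: "0 \<le> radius f k" by (induction k) (auto intro!: add_nonneg_nonneg sum_nonneg)
  show "radius f k + 1 \<le> radius f (Suc k)" unfolding Suc using g0 by (simp add: sum_nonneg)
  { assume "i \<le> Suc k"
    note b = gi[OF this] nonneg
    show "\<bar>f i (radius f k)\<bar> < radius f (Suc k)" "\<bar>f i (- radius f k)\<bar> < radius f (Suc k)"
      "\<bar>inv_fun (f i) (radius f k)\<bar> < radius f (Suc k)"
      "\<bar>inv_fun (f i) (- radius f k)\<bar> < radius f (Suc k)"
      using b unfolding Suc g_def by linarith+ }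
qed

lemma radius_ge: "of_nat k \<le> radius f k"
proof (induction k)
  case (Suc k) then show ?case using radius_Suc(1)[of f k] by simp
qed simp

lemma radius_strict_mono: "strict_mono (radius f)"
  unfolding strict_mono_Suc_iff using radius_Suc(1)[of f] by (metis less_add_one less_le_trans)

text \<open>The odd extension of \<open>radius\<close> to the integers, consistent at 0 because
  \<open>radius f 0 = 0\<close>.\<close>

definition grid :: "(nat \<Rightarrow> rat \<Rightarrow> rat) \<Rightarrow> int \<Rightarrow> rat" where
  "grid f k = (if 0 \<le> k then radius f (nat k) else - radius f (nat (- k)))"

lemma grid_strict_mono: "strict_mono (grid f)"
proof (rule strict_monoI)
  fix j k :: int assume "j < k"
  consider "0 \<le> j" "0 \<le> k" | "j < 0" "0 \<le> k" | "j < 0" "k < 0" using \<open>j < k\<close> by linarith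
  then show "grid f j < grid f k"
  proof cases
    case 1
    then have "nat j < nat k" using \<open>j < k\<close> by simp
    then show ?thesis using 1 strict_monoD[OF radius_strict_mono] by (simp add: grid_def)
  next
    case 2
    then have "radius f 0 < radius f (nat (- j))" by (intro strict_monoD[OF radius_strict_mono]) simp
    then show ?thesis using 2 radius_Suc(2)[of f "nat k"] by (simp add: grid_def)
  next
    case 3
    then have "nat (- k) < nat (- j)" using \<open>j < k\<close> by simp
    then show ?thesis using 3 strict_monoD[OF radius_strict_mono] by (simp add: grid_def)
  qed
qed

text \<open>Away from 0, values of \<open>f i\<close> bound the outward motion and values of its
  inverse the inward motion. The inward bound uses stage \<open>\<bar>k\<bar>\<close> of the
  recursion, whence the hypothesis on \<open>i\<close>.\<close>

lemma grid_moves_at_most_one: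
  assumes f: "f i \<in> Aut_on UNIV" and k: "int i \<le> \<bar>k\<bar>"
  shows "f i (grid f k) < grid f (k + 1)" "grid f (k - 1) < f i (grid f k)"
proof -
  have inv: "x < f i y" if "inv_fun (f i) x < y" for x y
    using Aut_on_less_iff(1)[OF f, of "inv_fun (f i) x" y] that f by simp
  have inv': "f i y < x" if "y < inv_fun (f i) x" for x y
    using Aut_on_less_iff(1)[OF f, of y "inv_fun (f i) x"] that f by simp
  have "f i (grid f k) < grid f (k + 1) \<and> grid f (k - 1) < f i (grid f k)"
  proof (cases "0 < k")
    case True
    then obtain n where n: "k = int (Suc n)" by (metis gr0_implies_Suc zero_less_imp_eq_int)
    have g: "grid f k = radius f (Suc n)" "grid f (k + 1) = radius f (Suc (Suc n))"
      "grid f (k - 1) = radius f n"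
      unfolding grid_def n by (auto simp: nat_add_distrib simp del: radius.simps(2))
    show ?thesis unfolding g using k radius_Suc(3)[of i "Suc n" f] radius_Suc(5)[of i n f]
      by (auto simp: n abs_less_iff simp del: radius.simps(2) intro!: inv)
  next
    case k0: False
    show ?thesis
    proof (cases "k = 0")
      case True
      have g: "grid f k = radius f 0" "grid f (k + 1) = radius f (Suc 0)"
        "grid f (k - 1) = - radius f (Suc 0)"
        unfolding grid_def True by (auto simp del: radius.simps(2))
      show ?thesis unfolding g using k radius_Suc(3)[of i 0 f]
        by (auto simp: True abs_less_iff simp del: radius.simps(2))
    next
      case False
      then have "0 < - k" using k0 by simp
      then obtain n where n: "- k = int (Suc n)" by (metis gr0_implies_Suc zero_less_imp_eq_int)
      then have kn: "k = - int (Suc n)" by simp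
      have g: "grid f k = - radius f (Suc n)" "grid f (k - 1) = - radius f (Suc (Suc n))"
        "grid f (k + 1) = - radius f n"
        unfolding grid_def kn by (auto simp: nat_add_distrib simp del: radius.simps(2))
      show ?thesis unfolding g using k radius_Suc(4)[of i "Suc n" f] radius_Suc(6)[of i n f]
        by (auto simp: kn abs_less_iff simp del: radius.simps(2) intro!: inv')
    qed
  qed
  then show "f i (grid f k) < grid f (k + 1)" "grid f (k - 1) < f i (grid f k)" by auto
qed

text \<open>\<open>c\<close> sends \<open>k/8\<close> to \<open>grid f k\<close>, so the conjugated
  map moves such points by less than 1/8 and the points between them by less than 2/8. The threshold
  \<open>Suc i\<close> is independent of the sequence, so the words can be fixed in advance.\<close>

lemma bound_displacement:
  fixes f :: "nat \<Rightarrow> rat \<Rightarrow> rat"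
  assumes f: "\<And>i. f i \<in> Aut_on UNIV"
  obtains c where "c \<in> Aut_on UNIV"
    "\<And>i x. of_nat (Suc i) \<le> \<bar>x\<bar> \<Longrightarrow> \<bar>inv_fun c (f i (c x)) - x\<bar> < 1/4"
proof -
  have above: "\<exists>k. y < grid f k" for y
  proof -
    obtain n where "y < of_nat n" using reals_Archimedean2 by blast
    then have "y < grid f (int n)" using radius_ge[of n f] by (simp add: grid_def)
    then show ?thesis ..
  qed
  have below: "\<exists>k. grid f k \<le> y" for y
  proof -
    obtain n where "- y < of_nat n" using reals_Archimedean2 by blast
    moreover have "grid f (- int n) = - radius f n" by (cases "n = 0") (simp_all add: grid_def)
    ultimately have "grid f (- int n) \<le> y" using radius_ge[of n f] by simp
    then show ?thesis ..
  qed
  obtain e where e: "e \<in> Aut_on UNIV" and eg: "\<And>k. e (of_int k) = grid f k"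
    using interpolate_Aut[OF grid_strict_mono above below] by blast
  define c where "c = e \<circ> (\<lambda>x. 0 + (x - 0) * 8)"
  have c: "c \<in> Aut_on UNIV" unfolding c_def by (intro comp_Aut_on[OF e] affine_Aut) simp
  have cx: "c x = e (8 * x)" for x by (simp add: c_def mult.commute)
  show thesis
  proof (rule that[OF c])
    fix i and x :: rat assume x: "of_nat (Suc i) \<le> \<bar>x\<bar>"
    define k where "k = \<lfloor>8 * x\<rfloor>"
    have k: "of_int k \<le> 8 * x" "8 * x < of_int (k + 1)"
      unfolding k_def by (simp_all add: algebra_simps) linarith
    have "of_nat (Suc i) \<le> 8 * x \<or> 8 * x \<le> - of_nat (Suc i)" using x by linarith
    \<comment> \<open>Both ends of the grid step around \<open>8 * x\<close> must be controlled; for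
      negative \<open>x\<close> the end \<open>k + 1\<close> uses up the extra unit in
      \<open>Suc i\<close>.\<close>
    then have "int i \<le> \<bar>k\<bar> \<and> int i \<le> \<bar>k + 1\<bar>"
    proof
      assume "of_nat (Suc i) \<le> 8 * x"
      then have "int (Suc i) \<le> k" unfolding k_def le_floor_iff by simp
      then show ?thesis by simp
    next
      assume "8 * x \<le> - of_nat (Suc i)"
      then have "of_int k \<le> (of_int (- int (Suc i)) :: rat)" using k(1) by simp
      then have "k \<le> - int (Suc i)" unfolding of_int_le_iff .
      then show ?thesis by simp
    qed
    then have i: "int i \<le> \<bar>k\<bar>" "int i \<le> \<bar>k + 1\<bar>" by auto
    define z where "z = inv_fun c (f i (c x))"
    have z: "e (8 * z) = f i (e (8 * x))" using Aut_on_inv(2)[OF c] by (simp add: z_def flip: cx)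
    have "e (of_int (k - 1)) < f i (e (of_int k))"
      unfolding eg by (rule grid_moves_at_most_one(2)[of f, OF f i(1)])
    also have "\<dots> \<le> e (8 * z)" unfolding z Aut_on_less_iff[OF f] Aut_on_less_iff[OF e] by (rule k)
    finally have 1: "of_int (k - 1) < 8 * z" unfolding Aut_on_less_iff[OF e] .
    have "e (8 * z) < f i (e (of_int (k + 1)))"
      unfolding z Aut_on_less_iff[OF f] Aut_on_less_iff[OF e] by (rule k)
    also have "\<dots> < e (of_int (k + 1 + 1))"
      unfolding eg by (rule grid_moves_at_most_one(1)[of f, OF f i(2)])
    finally have 2: "8 * z < of_int (k + 1 + 1)" unfolding Aut_on_less_iff[OF e] .
    show "\<bar>inv_fun c (f i (c x)) - x\<bar> < 1/4"
      using 1 2 k unfolding z_def[symmetric] abs_less_iff of_int_add of_int_diff of_int_1 by linarith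
  qed
qed

subsection \<open>The universal words\<close>

lemma fold_replicate: "fold \<rho> (replicate n x) = \<rho> x ^^ n"
  by (induction n) (simp_all add: funpow_Suc_right del: funpow.simps)

lemma fold_Aut_on: "(\<And>x. \<rho> x \<in> Aut_on W) \<Longrightarrow> fold \<rho> u \<in> Aut_on W"
  by (induction u) (auto simp: id_Aut_on comp_Aut_on)

theorem theorem3p6:
  fixes A :: "'a set"
  assumes "card A = 8"
  shows "\<exists>w :: nat \<Rightarrow> 'a list. universal_for A w Aut_rat"
proof -
  have "finite A" using assms by (metis card.infinite zero_neq_numeral)
  then obtain xs where xs: "set xs = A" "distinct xs" using finite_distinct_list by blast
  then have "length xs = 8" using assms distinct_card by metis
  \<comment> \<open>A free semigroup has no inverses, so each of the four automorphisms takes a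
    second, primed letter for its inverse.\<close>
  then obtain S S' T T' D D' X X' where "xs = [S, S', T, T', D, D', X, X']"
    by (auto simp: numeral_eq_Suc length_Suc_conv)
  then have A: "A = {S, S', T, T', D, D', X, X'}" and dist: "distinct [S, S', T, T', D, D', X, X']"
    using xs by auto
  \<comment> \<open>The commutator of \<open>encode_sequence\<close> read from right to left: the
    first letter of a word acts first, as in \<open>fold\<close> and in the product of
    \<open>Aut_rat\<close>.\<close>
  define v where "v j = [S'] @ replicate j T @ [X'] @ replicate j T' @ [S] @ replicate j T @ [X]
    @ replicate j T'" for j
  \<comment> \<open>\<open>Suc i\<close> is the threshold of \<open>bound_displacement\<close>. The
    factor supported on the odd power comes first because it acts first; the two factors use the
    entries \<open>2 * i + 1\<close> and \<open>2 * i\<close> of one encoded sequence.\<close>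
  define w where "w i = replicate (2 * Suc i + 1) D' @ v (2 * i + 1) @ replicate (2 * Suc i + 1) D
    @ replicate (2 * Suc i) D' @ v (2 * i) @ replicate (2 * Suc i) D" for i
  let ?W = "cells {1/8<..<7/8}" and ?I = "cells {1/16<..<15/16}"
  obtain s where s: "s \<in> Aut_on ?I" and ds: "disjoint_family (\<lambda>n. (s ^^ n) ` ?W)"
    using periodic_shift[of "1/16" "1/8" "7/8" "15/16"] by auto
  obtain t where t: "t \<in> Aut_on (cells {0<..<1})" and dt: "disjoint_family (\<lambda>n. (t ^^ n) ` ?I)"
    using periodic_shift[of 0 "1/16" "15/16" 1] by auto
  obtain d where d: "d \<in> Aut_on UNIV"
    "\<And>x. 3/4 \<le> x \<Longrightarrow> d x = x + 1/2" "\<And>x. x \<le> 1/4 \<Longrightarrow> d x = x - 1/2"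
    using dilation_exists by blast
  have WI: "?W \<subseteq> ?I" by (auto simp: cells_def)
  have "\<exists>\<phi> \<in> hom (free_semigroup A) Aut_rat. \<forall>i. \<phi> (w i) = f i"
    if "\<forall>i. f i \<in> carrier Aut_rat" for f
  proof -
    have f: "f i \<in> Aut_on UNIV" for i using that by (simp add: Aut_on_UNIV)
    obtain c where c: "c \<in> Aut_on UNIV" and near:
      "\<And>i x. of_nat (Suc i) \<le> \<bar>x\<bar> \<Longrightarrow> \<bar>inv_fun c (f i (c x)) - x\<bar> < 1/4"
      by (rule bound_displacement[of f, OF f]) (erule that, blast)
    define f' where "f' i = inv_fun c \<circ> f i \<circ> c" for i
    have f': "f' i \<in> Aut_on UNIV" for i
      unfolding f'_def by (intro comp_Aut_on inv_Aut_on c f)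
    have "\<exists>a b. a \<in> Aut_on ((d ^^ (2 * Suc i)) ` ?W) \<and>
      b \<in> Aut_on ((d ^^ (2 * Suc i + 1)) ` ?W) \<and> f' i = a \<circ> b" for i
    proof -
      have "\<bar>f' i x - x\<bar> < 1/4" if "of_nat (Suc i) \<le> \<bar>x\<bar>" for x
        using near[OF that] by (simp add: f'_def)
      from decompose[OF d f'[of i] this] show ?thesis by metis
    qed
    then obtain a b where a: "\<And>i. a i \<in> Aut_on ((d ^^ (2 * Suc i)) ` ?W)"
      and b: "\<And>i. b i \<in> Aut_on ((d ^^ (2 * Suc i + 1)) ` ?W)" and ab: "\<And>i. f' i = a i \<circ> b i"
      by metis
    \<comment> \<open>Conjugation brings all supports back to the common set \<open>?W\<close>, as
      the encoding requires.\<close>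
    define pull where "pull n g = (inv_fun d ^^ n) \<circ> g \<circ> (d ^^ n)" for n g
    have pull: "pull n g \<in> Aut_on ?W" if "g \<in> Aut_on ((d ^^ n) ` ?W)" for n g
    proof -
      have "inv_fun (inv_fun d ^^ n) = d ^^ n"
        using Aut_onD(1)[OF d(1)] by (simp add: inv_fn inv_inv_eq bij_imp_bij_inv)
      moreover have "(inv_fun d ^^ n) ` (d ^^ n) ` ?W = ?W"
        using inv_funpow_Aut_on(1)[OF d(1)] by (simp add: image_image)
      ultimately show ?thesis
        using conj_Aut_on[OF funpow_Aut_on[OF inv_Aut_on[OF d(1)], of n] that] by (simp add: pull_def)
    qed
    have push: "(d ^^ n) \<circ> pull n g \<circ> (inv_fun d ^^ n) = g" for n g
      using inv_funpow_Aut_on[OF d(1)] by (simp add: pull_def fun_eq_iff)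
    define \<alpha> where "\<alpha> i = pull (2 * Suc i) (a i)" for i
    define \<beta> where "\<beta> i = pull (2 * Suc i + 1) (b i)" for i
    define h where "h j = (if even j then \<alpha> (j div 2) else \<beta> (j div 2))" for j
    have "\<alpha> i \<in> Aut_on ?W" "\<beta> i \<in> Aut_on ?W" for i
      unfolding \<alpha>_def \<beta>_def by (rule pull[OF a], rule pull[OF b])
    then have h: "h j \<in> Aut_on ?W" for j by (simp add: h_def)
    have h_\<alpha>\<beta>: "h (2 * i) = \<alpha> i" "h (2 * i + 1) = \<beta> i" for i by (simp_all add: h_def)
    obtain F where F: "F \<in> Aut_on UNIV" and Fh: "\<And>j. (inv_fun t ^^ j) \<circ> F \<circ> (t ^^ j) \<circ> s
      \<circ> (inv_fun t ^^ j) \<circ> inv_fun F \<circ> (t ^^ j) \<circ> inv_fun s = h j"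
      by (rule encode_sequence[of s ?I t _ ?W h, OF s t WI ds dt h]) (erule that, blast)
    \<comment> \<open>Letters outside \<open>A\<close> default to \<open>id\<close>, so every word
      over the type evaluates to an automorphism.\<close>
    define \<rho> where "\<rho> = (\<lambda>_. id)(S := s, S' := inv_fun s, T := t, T' := inv_fun t,
      D := d, D' := inv_fun d, X := F, X' := inv_fun F)"
    have \<rho>: "\<rho> S = s" "\<rho> S' = inv_fun s" "\<rho> T = t" "\<rho> T' = inv_fun t"
      "\<rho> D = d" "\<rho> D' = inv_fun d" "\<rho> X = F" "\<rho> X' = inv_fun F"
      using dist by (auto simp: \<rho>_def)
    have "\<rho> x \<in> Aut_on UNIV" for x
      unfolding \<rho>_def using Aut_on_UNIV_I[OF s] Aut_on_UNIV_I[OF t] d(1) F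
      by (auto simp: id_Aut_on inv_Aut_on)
    then have fold: "fold \<rho> u \<in> Aut_on UNIV" for u by (rule fold_Aut_on)
    have v: "fold \<rho> (v j) = h j" for j
      unfolding Fh[symmetric] v_def by (simp add: fold_replicate \<rho> comp_assoc)
    have w: "fold \<rho> (w i) = f' i" for i
    proof -
      have "fold \<rho> (w i) = ((d ^^ (2 * Suc i)) \<circ> h (2 * i) \<circ> (inv_fun d ^^ (2 * Suc i)))
        \<circ> ((d ^^ (2 * Suc i + 1)) \<circ> h (2 * i + 1) \<circ> (inv_fun d ^^ (2 * Suc i + 1)))"
        unfolding w_def by (simp only: fold_append fold_replicate v \<rho> comp_assoc)
      also have "\<dots> = a i \<circ> b i"
        unfolding h_\<alpha>\<beta> \<alpha>_def \<beta>_def push ..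
      finally show ?thesis by (simp add: ab)
    qed
    \<comment> \<open>The normalising \<open>c\<close> is absorbed into the homomorphism, as a
      conjugation of the value of every letter, and so costs no letter.\<close>
    define \<phi> where "\<phi> u = c \<circ> fold \<rho> u \<circ> inv_fun c" for u
    have "\<phi> \<in> hom (free_semigroup A) Aut_rat"
    proof (rule homI)
      show "\<phi> u \<in> carrier Aut_rat" for u
        unfolding \<phi>_def Aut_on_UNIV by (intro comp_Aut_on inv_Aut_on c fold)
      show "\<phi> (x \<otimes>\<^bsub>free_semigroup A\<^esub> y) = \<phi> x \<otimes>\<^bsub>Aut_rat\<^esub> \<phi> y" for x y
        using Aut_on_inv(1)[OF c] by (simp add: \<phi>_def free_semigroup_def Aut_rat_def fun_eq_iff)
    qed
    moreover have "\<phi> (w i) = f i" for i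
      using w Aut_on_inv(2)[OF c] by (simp add: \<phi>_def f'_def fun_eq_iff)
    ultimately show ?thesis by blast
  qed
  moreover have "w i \<in> carrier (free_semigroup A)" for i
    by (auto simp: w_def v_def free_semigroup_def A)
  ultimately show ?thesis
    unfolding universal_for_def universal_for_subset_def by blast
qed

end
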